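(* Let $q\in\Pi_d$ satisfy $\|q\|_1\le \dfrac{\binom{n}{d}}{2^n\cdot n^{(d+1)(n-d)}}$. Then $e_d+q$ is hyperbolic with respect to $\mathbf{1}=(1,\dots,1)\in\mathbb{R}^n$.
   Context: Let $n\ge 2d\ge 2$. $e_d(x)=\sum_{S\subseteq[n],|S|=d}\prod_{i\in S}x_i$. A $d$-matching on $[n]$ is a set of $d$ pairwise disjoint $2$-element subsets of $[n]$; for such $M$, $q_M(x)=\prod_{\{i,j\}\in M,\,i<j}(x_i-x_j)$. $M$ fully crosses a $d$-subset $S$ if every edge of $M$ has exactly one endpoint in $S$. Fix a set $\mathcal{M}_d$ of $d$-matchings on $[n]$ and a set $\mathcal{S}_d$ of $d$-subsets of $[n]$ such that every $S\in\mathcal{S}_d$ is fully crossed by exactly one $M\in\mathcal{M}_d$ and every $M\in\mathcal{M}_d$ fully crosses at least one $S\in\mathcal{S}_d$ (so the $q_M$, $M\in\mathcal{M}_d$, are linearly independent). $\Pi_d$ is the span of $\{q_M:M\in\mathcal{M}_d\}$, and for $q=\sum_{M\in\mathcal{M}_d}s_Mq_M$ we set $\|q\|_1=\sum_M|s_M|$. A homogeneous polynomial $p$ is hyperbolic with respect to $e$ if $p(e)\ne0$ and $t\mapsto p(te+x)$ is real-rooted for every $x\in\mathbb{R}^n$. *)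

theory Defs
  imports Complex_Main "HOL-Computational_Algebra.Polynomial"
begin

text \<open>Points of R^n are functions nat => real; only coordinates 1..n matter.\<close>

definition elem_sym :: "nat \<Rightarrow> nat \<Rightarrow> (nat \<Rightarrow> real) \<Rightarrow> real" where
  "elem_sym n d x = (\<Sum>S\<in>{S. S \<subseteq> {1..n} \<and> card S = d}. \<Prod>i\<in>S. x i)"

definition is_matching :: "nat \<Rightarrow> nat \<Rightarrow> nat set set \<Rightarrow> bool" where
  "is_matching n d M \<longleftrightarrow>
     (\<forall>e\<in>M. e \<subseteq> {1..n} \<and> card e = 2) \<and> card M = d \<and>
     (\<forall>e\<in>M. \<forall>f\<in>M. e \<noteq> f \<longrightarrow> e \<inter> f = {})"

definition q_match :: "nat set set \<Rightarrow> (nat \<Rightarrow> real) \<Rightarrow> real" where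
  "q_match M x = (\<Prod>e\<in>M. x (Min e) - x (Max e))"

definition fully_crosses :: "nat set set \<Rightarrow> nat set \<Rightarrow> bool" where
  "fully_crosses M S \<longleftrightarrow> (\<forall>e\<in>M. card (e \<inter> S) = 1)"

definition real_rooted :: "real poly \<Rightarrow> bool" where
  "real_rooted c \<longleftrightarrow> (\<forall>z::complex. poly (map_poly complex_of_real c) z = 0 \<longrightarrow> Im z = 0)"

definition hyperbolic_wrt :: "((nat \<Rightarrow> real) \<Rightarrow> real) \<Rightarrow> (nat \<Rightarrow> real) \<Rightarrow> bool" where
  "hyperbolic_wrt p e \<longleftrightarrow> p e \<noteq> 0 \<and>
     (\<forall>x. \<exists>c::real poly. (\<forall>t. poly c t = p (\<lambda>i. t * e i + x i)) \<and> real_rooted c)"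

end

theory Submission
  imports Defs
begin

text \<open>
  The matching products are invariant under translation along the all-ones vector, so along a line
  in that direction \<open>q\<close> is a constant \<open>c\<close>, while \<open>e\<^sub>d\<close> is, up to a factor, the \<open>(n - d)\<close>-th
  derivative of \<open>\<Prod>\<^sub>i (t + x\<^sub>i)\<close>. For distinct roots
  \<open>y\<^sub>0 < y\<^sub>1 < \<dots>\<close>, each root of a derivative keeps a distance of at least a fraction \<open>1/n\<close> of the
  gap from both ends of its gap, so the roots \<open>r\<^sub>i\<close> of the \<open>k\<close>-th derivative satisfy
  \<open>r\<^sub>j - r\<^sub>i \<ge> (y\<^sub>j\<^sub>+\<^sub>k - y\<^sub>i) / n\<^sup>k\<close>. Hence at the midpoints of consecutive roots the unshifted
  polynomial is larger in absolute value than any \<open>|c|\<close> allowed by the norm bound, and its signs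
  there still alternate after the shift. Coinciding coordinates are handled by a limit:
  a polynomial of degree \<open>d\<close> with leading coefficient \<open>C\<close> and only real roots satisfies
  \<open>|p z| \<ge> |C| |Im z|\<^sup>d\<close>, and this inequality is closed under limits.
\<close>

section \<open>Polynomials with distinct real roots and their critical points\<close>

lemma poly_eq_smult_prod_distinct_roots:
  fixes p :: "real poly"
  assumes "inj_on r {..<m}" and "\<And>i. i < m \<Longrightarrow> poly p (r i) = 0" and "degree p \<le> m"
  shows "p = smult (coeff p m) (\<Prod>i<m. [:- r i, 1:])"
proof (rule poly_eqI_degree_lead_coeff[where A = "r ` {..<m}" and n = m])
  have deg: "degree (\<Prod>i<m. [:- r i, 1:]) = m"
    by (subst degree_prod_sum_eq) auto
  moreover have "lead_coeff (\<Prod>i<m. [:- r i, 1:]) = 1"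
    by (simp add: lead_coeff_prod)
  ultimately show "coeff p m = coeff (smult (coeff p m) (\<Prod>i<m. [:- r i, 1:])) m"
    by simp
  show "degree (smult (coeff p m) (\<Prod>i<m. [:- r i, 1:])) \<le> m"
    using deg degree_smult_le by metis
  show "m \<le> card (r ` {..<m})"
    using assms(1) by (simp add: card_image)
  show "poly p z = poly (smult (coeff p m) (\<Prod>i<m. [:- r i, 1:])) z" if "z \<in> r ` {..<m}" for z
    using that assms(2) by (auto simp: poly_prod)
qed (use assms in auto)

lemma poly_pderiv_prod_roots:
  fixes y :: "'a \<Rightarrow> real"
  assumes "finite A" and "\<And>i. i \<in> A \<Longrightarrow> z \<noteq> y i"
  shows "poly (pderiv (\<Prod>i\<in>A. [:- y i, 1:])) z = (\<Prod>i\<in>A. z - y i) * (\<Sum>i\<in>A. 1 / (z - y i))"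
proof -
  have "poly (pderiv (\<Prod>i\<in>A. [:- y i, 1:])) z = (\<Sum>i\<in>A. \<Prod>j\<in>A - {i}. z - y j)"
    by (simp add: pderiv_prod pderiv_pCons poly_sum poly_prod algebra_simps)
  also have "\<dots> = (\<Sum>i\<in>A. (\<Prod>i\<in>A. z - y i) * (1 / (z - y i)))"
    using assms by (intro sum.cong refl) (simp add: prod.remove field_simps)
  finally show ?thesis
    by (simp add: sum_distrib_left)
qed

text \<open>At a root of the derivative the sum of all \<open>1 / (z - y\<^sub>j)\<close> vanishes, so of the two terms
  belonging to the neighbours of \<open>z\<close> each is at most \<open>m\<close> times the other in modulus.\<close>

lemma critical_point_separation:
  fixes y :: "nat \<Rightarrow> real"
  assumes "strict_mono_on {..m} y" and "i < m"
  obtains z where "y i < z" and "z < y (Suc i)"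
    and "poly (pderiv (\<Prod>j\<le>m. [:- y j, 1:])) z = 0"
    and "y i + (y (Suc i) - y i) / real (Suc m) \<le> z"
    and "z \<le> y (Suc i) - (y (Suc i) - y i) / real (Suc m)"
proof -
  let ?p = "\<Prod>j\<le>m. [:- y j, 1:]"
  have lt: "y j < y k" if "j < k" "k \<le> m" for j k
    using strict_mono_onD[OF assms(1), of j k] that by simp
  have le: "y j \<le> y k" if "j \<le> k" "k \<le> m" for j k
    using lt[of j k] that by (cases "j = k") auto
  have root: "poly ?p (y j) = 0" if "j \<le> m" for j
    using that by (auto simp: poly_prod)
  obtain z where z: "y i < z" "z < y (Suc i)"
    and "poly ?p (y (Suc i)) - poly ?p (y i) = (y (Suc i) - y i) * poly (pderiv ?p) z"
    using poly_MVT[of "y i" "y (Suc i)" ?p] lt[of i "Suc i"] assms(2) by auto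
  then have crit: "poly (pderiv ?p) z = 0"
    using root[of i] root[of "Suc i"] assms(2) by auto
  have left: "y j \<le> y i" if "j \<le> i" for j
    using le[of j i] that assms(2) by simp
  have right: "y (Suc i) \<le> y j" if "i < j" "j \<le> m" for j
    using le[of "Suc i" j] that by simp
  have ne: "z \<noteq> y j" if "j \<le> m" for j
    using left[of j] right[of j] z that by (cases "j \<le> i") auto
  have zero: "(\<Sum>j\<le>m. 1 / (z - y j)) = 0"
    using crit ne by (subst (asm) poly_pderiv_prod_roots) auto
  \<comment> \<open>Only the points to the right of \<open>z\<close> give negative terms, and the
    nearest of them, \<open>y (Suc i)\<close>, gives the most negative one; \<open>upper\<close> is
    the mirror image.\<close>
  have lower: "- (1 / (y (Suc i) - z)) \<le> 1 / (z - y j)" if "j \<le> m" for j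
  proof (cases "j \<le> i")
    case True
    then have "0 < 1 / (z - y j)" "0 < 1 / (y (Suc i) - z)" using left[of j] z by auto
    then show ?thesis by linarith
  next
    case False
    then have "1 / (y j - z) \<le> 1 / (y (Suc i) - z)"
      using right[of j] z that by (intro divide_left_mono mult_pos_pos) auto
    moreover have "1 / (z - y j) = - (1 / (y j - z))"
      by (metis minus_diff_eq minus_divide_right)
    ultimately show ?thesis by simp
  qed
  have upper: "1 / (z - y j) \<le> 1 / (z - y i)" if "j \<le> m" for j
  proof (cases "j \<le> i")
    case True
    then show ?thesis using left[of j] z by (intro divide_left_mono mult_pos_pos) auto
  next
    case False
    then have "1 / (z - y j) < 0" "0 < 1 / (z - y i)" using right[of j] z that by auto
    then show ?thesis by linarith
  qed
  \<comment> \<open>In the vanishing sum one neighbour's term is isolated and the other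
    \<open>m\<close> terms are estimated by the opposite neighbour's.\<close>
  have A: "real m * - (1 / (y (Suc i) - z)) \<le> (\<Sum>j\<in>{..m} - {i}. 1 / (z - y j))"
    using sum_bounded_below[of "{..m} - {i}" "- (1 / (y (Suc i) - z))" "\<lambda>j. 1 / (z - y j)"]
      lower assms(2) by simp
  have "(\<Sum>j\<le>m. 1 / (z - y j)) = 1 / (z - y i) + (\<Sum>j\<in>{..m} - {i}. 1 / (z - y j))"
    using assms(2) by (intro sum.remove) auto
  with A zero have A': "1 / (z - y i) \<le> real m / (y (Suc i) - z)" by simp
  have B: "(\<Sum>j\<in>{..m} - {Suc i}. 1 / (z - y j)) \<le> real m * (1 / (z - y i))"
    using sum_bounded_above[of "{..m} - {Suc i}" "\<lambda>j. 1 / (z - y j)" "1 / (z - y i)"]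
      upper assms(2) by simp
  have "(\<Sum>j\<le>m. 1 / (z - y j)) = 1 / (z - y (Suc i)) + (\<Sum>j\<in>{..m} - {Suc i}. 1 / (z - y j))"
    using assms(2) by (intro sum.remove) auto
  moreover have "1 / (z - y (Suc i)) = - (1 / (y (Suc i) - z))"
    by (metis minus_diff_eq minus_divide_right)
  ultimately have B': "1 / (y (Suc i) - z) \<le> real m / (z - y i)" using B zero by simp
  have "y (Suc i) - z \<le> real m * (z - y i)" "z - y i \<le> real m * (y (Suc i) - z)"
    using A' B' z by (simp_all add: field_simps)
  then have "y i + (y (Suc i) - y i) / real (Suc m) \<le> z"
    "z \<le> y (Suc i) - (y (Suc i) - y i) / real (Suc m)"
    by (simp_all add: field_simps)
  then show thesis using that z crit by blast
qed

section \<open>Elementary symmetric polynomials along the all-ones direction\<close>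

text \<open>The restriction of \<open>elem_sym n d\<close> to the line through \<open>x\<close> in
  the all-ones direction, as a polynomial in the line parameter. The general coefficient domain lets
  the same formula serve over the complex numbers.\<close>

definition esym_poly :: "nat \<Rightarrow> nat \<Rightarrow> (nat \<Rightarrow> 'a::idom) \<Rightarrow> 'a poly" where
  "esym_poly n d x = (\<Sum>S | S \<subseteq> {1..n} \<and> card S = d. \<Prod>i\<in>S. [:x i, 1:])"

lemma finite_subsets_card [simp]: "finite {S. S \<subseteq> {1..n::nat} \<and> card S = d}"
  by (rule finite_subset[of _ "Pow {1..n}"]) auto

lemma poly_esym_poly: "poly (esym_poly n d x) t = elem_sym n d (\<lambda>i. t + x i)"
  by (simp add: esym_poly_def elem_sym_def poly_sum poly_prod add.commute)

lemma esym_poly_degree_coeff: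
  shows "degree (esym_poly n d x) \<le> d" and "coeff (esym_poly n d x) d = of_nat (n choose d)"
proof -
  have deg: "degree (\<Prod>i\<in>S. [:x i, 1:]) = card S" for S
    by (subst degree_prod_sum_eq) auto
  have lead: "coeff (\<Prod>i\<in>S. [:x i, 1:]) (card S) = 1" for S
    using lead_coeff_prod[of "\<lambda>i. [:x i, 1:]" S] by (simp add: deg)
  show "degree (esym_poly n d x) \<le> d"
    unfolding esym_poly_def by (rule degree_sum_le) (auto simp: deg)
  have "coeff (esym_poly n d x) d = (\<Sum>S | S \<subseteq> {1..n} \<and> card S = d. 1)"
    unfolding esym_poly_def coeff_sum using lead by (intro sum.cong) auto
  then show "coeff (esym_poly n d x) d = of_nat (n choose d)"
    by (simp add: n_subsets)
qed

lemma pderiv_sum: "pderiv (\<Sum>i\<in>A. f i) = (\<Sum>i\<in>A. pderiv (f i))"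
  by (induction A rule: infinite_finite_induct) (auto simp: pderiv_add)

text \<open>Double counting: differentiation deletes one element \<open>i\<close> from a set
  \<open>S\<close>, and each \<open>d\<close>-subset \<open>T\<close> of \<open>{1..n}\<close>
  arises from \<open>n - d\<close> pairs, one for each \<open>i\<close> outside
  \<open>T\<close>.\<close>

lemma pderiv_esym_poly:
  "pderiv (esym_poly n (Suc d) x) = smult (of_nat (n - d)) (esym_poly n d x)"
proof -
  let ?A = "\<lambda>d. {S. S \<subseteq> {1..n} \<and> card S = d}"
  let ?f = "\<lambda>S. \<Prod>i\<in>S. [:x i, 1:]"
  have fin: "finite S" if "S \<in> ?A k" for S k
    using that finite_subset by blast
  have "pderiv (esym_poly n (Suc d) x) = (\<Sum>S\<in>?A (Suc d). \<Sum>i\<in>S. ?f (S - {i}))"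
    unfolding esym_poly_def by (simp add: pderiv_sum pderiv_prod pderiv_pCons)
  also have "\<dots> = (\<Sum>(S, i)\<in>Sigma (?A (Suc d)) (\<lambda>S. S). ?f (S - {i}))"
    using fin by (subst sum.Sigma) auto
  also have "\<dots> = (\<Sum>(T, i)\<in>Sigma (?A d) (\<lambda>T. {1..n} - T). ?f T)"
  proof (rule sum.reindex_bij_witness[of _ "\<lambda>(T, i). (insert i T, i)" "\<lambda>(S, i). (S - {i}, i)"],
      goal_cases)
    case (4 a)
    then obtain T i where "a = (T, i)" "T \<subseteq> {1..n}" "card T = d" "i \<in> {1..n} - T" by auto
    then show ?case using fin[of T d] by auto
  qed auto
  also have "\<dots> = (\<Sum>T\<in>?A d. \<Sum>i\<in>{1..n} - T. ?f T)"
    using fin by (subst sum.Sigma) auto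
  also have "\<dots> = (\<Sum>T\<in>?A d. of_nat (n - d) * ?f T)"
  proof (rule sum.cong[OF refl])
    fix T assume T: "T \<in> ?A d"
    then have "card ({1..n} - T) = n - d"
      using fin[OF T] by (subst card_Diff_subset) auto
    then show "(\<Sum>i\<in>{1..n} - T. ?f T) = of_nat (n - d) * ?f T"
      by simp
  qed
  finally have "pderiv (esym_poly n (Suc d) x) = of_nat (n - d) * esym_poly n d x"
    by (simp only: esym_poly_def sum_distrib_left)
  then show ?thesis
    by (simp add: of_nat_poly)
qed

section \<open>Root gaps of iterated derivatives\<close>

lemma sorted_enumeration:
  fixes A :: "'a::linorder set"
  assumes "finite A"
  obtains y where "strict_mono_on {..<card A} y" and "bij_betw y {..<card A} A"
proof
  let ?l = "sorted_list_of_set A"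
  have sorted: "sorted_wrt (<) ?l"
    by (rule strict_sorted_list_of_set)
  have set: "set ?l = A" and len: "length ?l = card A"
    using assms by (auto simp: length_sorted_list_of_set)
  show "strict_mono_on {..<card A} (\<lambda>i. ?l ! i)"
    using sorted len by (auto intro!: strict_mono_onI sorted_wrt_nth_less[OF sorted])
  show "bij_betw (\<lambda>i. ?l ! i) {..<card A} A"
    by (rule bij_betw_nth) (use set len in auto)
qed

text \<open>Induction on the number \<open>k\<close> of differentiations. Each one puts a root into
  every gap, so one root is lost and the upper index in the gap bound moves up by one, at the cost
  of a factor \<open>n\<close>.\<close>

lemma esym_poly_roots:
  fixes x :: "nat \<Rightarrow> real" and y :: "nat \<Rightarrow> real"
  assumes "strict_mono_on {..<n} y" and "bij_betw y {..<n} ((\<lambda>i. - x i) ` {1..n})"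
    and "inj_on x {1..n}" and "k \<le> n"
  shows "\<exists>r. strict_mono_on {..<n - k} r \<and>
    esym_poly n (n - k) x = smult (real (n choose k)) (\<Prod>i<n - k. [:- r i, 1:]) \<and>
    (\<forall>i j. i < j \<longrightarrow> j < n - k \<longrightarrow> (y (j + k) - y i) / real n ^ k \<le> r j - r i)"
  using assms(4)
proof (induction k)
  case 0
  have inj: "inj_on (\<lambda>i. - x i) {1..n}"
    by (rule inj_onI) (use inj_onD[OF assms(3)] in \<open>simp only: neg_equal_iff_equal\<close>)
  have "S \<subseteq> {1..n} \<and> card S = n \<longleftrightarrow> S = {1..n}" for S
  proof
    assume "S \<subseteq> {1..n} \<and> card S = n"
    then show "S = {1..n}" by (intro card_subset_eq) simp_all
  qed simp
  then have "{S. S \<subseteq> {1..n} \<and> card S = n} = {{1..n}}"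
    by (simp only: singleton_conv)
  then have "esym_poly n n x = (\<Prod>i\<in>{1..n}. [:x i, 1:])"
    by (simp add: esym_poly_def)
  also have "\<dots> = (\<Prod>v\<in>(\<lambda>i. - x i) ` {1..n}. [:- v, 1:])"
    by (simp only: prod.reindex[OF inj] o_def minus_minus)
  also have "\<dots> = (\<Prod>i<n. [:- y i, 1:])"
    by (rule prod.reindex_bij_betw[OF assms(2), symmetric])
  finally have "esym_poly n n x = (\<Prod>i<n. [:- y i, 1:])" .
  then show ?case using assms(1) by - (rule exI[of _ y], simp)
next
  case (Suc k)
  define m where "m = n - Suc k"
  have m: "n - k = Suc m" "n - Suc k = m" "Suc m \<le> n" "n - m = Suc k"
    using Suc.prems by (auto simp: m_def)
  obtain r where "strict_mono_on {..<n - k} r"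
    and "esym_poly n (n - k) x = smult (real (n choose k)) (\<Prod>i<n - k. [:- r i, 1:])"
    and "\<And>i j. i < j \<Longrightarrow> j < n - k \<Longrightarrow> (y (j + k) - y i) / real n ^ k \<le> r j - r i"
    using Suc.IH Suc_leD[OF Suc.prems] by blast
  then have r: "strict_mono_on {..m} r"
    and E: "esym_poly n (Suc m) x = smult (real (n choose k)) (\<Prod>i\<le>m. [:- r i, 1:])"
    and gap: "\<And>i j. i < j \<Longrightarrow> j \<le> m \<Longrightarrow> (y (j + k) - y i) / real n ^ k \<le> r j - r i"
    by (simp_all only: m(1) lessThan_Suc_atMost less_Suc_eq_le)
  have n0: "n > 0" using m by simp
  have lt: "r j < r k" if "j < k" "k \<le> m" for j k
    using strict_mono_onD[OF r, of j k] that by simp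
  have "\<exists>z. r i < z \<and> z < r (Suc i) \<and>
      poly (pderiv (\<Prod>j\<le>m. [:- r j, 1:])) z = 0 \<and>
      r i + (r (Suc i) - r i) / real (Suc m) \<le> z \<and>
      z \<le> r (Suc i) - (r (Suc i) - r i) / real (Suc m)" if "i < m" for i
    by (rule critical_point_separation[OF r that]) blast
  then obtain z where z: "\<And>i. i < m \<Longrightarrow> r i < z i" "\<And>i. i < m \<Longrightarrow> z i < r (Suc i)"
    "\<And>i. i < m \<Longrightarrow> poly (pderiv (\<Prod>j\<le>m. [:- r j, 1:])) (z i) = 0"
    "\<And>i. i < m \<Longrightarrow> r i + (r (Suc i) - r i) / real (Suc m) \<le> z i"
    "\<And>i. i < m \<Longrightarrow> z i \<le> r (Suc i) - (r (Suc i) - r i) / real (Suc m)"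
    by metis
  have gap_n: "(r (Suc i) - r i) / real n \<le> (r (Suc i) - r i) / real (Suc m)" if "i < m" for i
    using lt[of i "Suc i"] that m(3) by (intro divide_left_mono) auto
  have mono: "strict_mono_on {..<m} z"
  proof (rule strict_mono_onI)
    fix i j assume ij: "i \<in> {..<m}" "j \<in> {..<m}" "i < j"
    have "r (Suc i) \<le> r j" using lt[of "Suc i" j] ij by (cases "Suc i = j") auto
    then show "z i < z j" using z(1)[of j] z(2)[of i] ij by simp
  qed
  have "poly (esym_poly n m x) (z i) = 0" if "i < m" for i
  proof -
    have "poly (pderiv (esym_poly n (Suc m) x)) (z i) = 0"
      using z(3)[OF that] by (simp add: E pderiv_smult)
    then show ?thesis using m(4) by (simp add: pderiv_esym_poly)
  qed
  then have "esym_poly n m x = smult (real (n choose m)) (\<Prod>i<m. [:- z i, 1:])"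
    using poly_eq_smult_prod_distinct_roots[of z m "esym_poly n m x"]
      esym_poly_degree_coeff[of n m x] strict_mono_on_imp_inj_on[OF mono] by simp
  moreover have "n choose m = n choose Suc k"
    using Suc.prems m binomial_symmetric by metis
  moreover have "(y (j + Suc k) - y i) / real n ^ Suc k \<le> z j - z i" if "i < j" "j < m" for i j
  proof -
    have "(y (j + Suc k) - y i) / real n ^ Suc k = (y (Suc j + k) - y i) / real n ^ k / real n"
      by (simp add: field_simps)
    also have "\<dots> \<le> (r (Suc j) - r i) / real n"
      using gap[of i "Suc j"] that by (intro divide_right_mono) auto
    also have "\<dots> = (r (Suc j) - r j) / real n + (r j - r (Suc i)) / real n
        + (r (Suc i) - r i) / real n"
      by (simp add: add_divide_distrib[symmetric])
    also have "(r j - r (Suc i)) / real n \<le> r j - r (Suc i)"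
    proof -
      have "0 \<le> r j - r (Suc i)" using lt[of "Suc i" j] that by (cases "Suc i = j") auto
      from mult_left_mono[OF _ this, of 1 "real n"] show ?thesis
        using n0 by (simp add: divide_le_eq)
    qed
    finally show ?thesis
      using z(4)[of j] z(5)[of i] gap_n[of i] gap_n[of j] that by linarith
  qed
  ultimately show ?case using mono unfolding m(2) by (intro exI[of _ z]) simp
qed

section \<open>Real-rootedness under a constant shift\<close>

text \<open>The \<open>m\<close> sign changes yield \<open>m\<close> distinct roots, which exhaust
  the degree.\<close>

lemma roots_of_alternating:
  fixes p :: "real poly"
  assumes "strict_mono_on {..m} \<eta>" and "degree p \<le> m"
    and "\<And>k. k < m \<Longrightarrow> poly p (\<eta> k) * poly p (\<eta> (Suc k)) < 0"
  shows "\<exists>r. p = smult (coeff p m) (\<Prod>i<m. [:- r i, 1:])"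
proof -
  have lt: "\<eta> j < \<eta> k" if "j < k" "k \<le> m" for j k
    using strict_mono_onD[OF assms(1), of j k] that by simp
  have "\<exists>z. \<eta> k < z \<and> z < \<eta> (Suc k) \<and> poly p z = 0" if "k < m" for k
    using poly_IVT[OF lt assms(3)[OF that]] that by auto
  then obtain r where r: "\<And>k. k < m \<Longrightarrow> \<eta> k < r k" "\<And>k. k < m \<Longrightarrow> r k < \<eta> (Suc k)"
    "\<And>k. k < m \<Longrightarrow> poly p (r k) = 0"
    by metis
  have "strict_mono_on {..<m} r"
  proof (rule strict_mono_onI)
    fix i j assume ij: "i \<in> {..<m}" "j \<in> {..<m}" "i < j"
    have "\<eta> (Suc i) \<le> \<eta> j" using lt[of "Suc i" j] ij by (cases "Suc i = j") auto
    then show "r i < r j" using r(1)[of j] r(2)[of i] ij by simp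
  qed
  then show ?thesis
    using poly_eq_smult_prod_distinct_roots[of r m p] strict_mono_on_imp_inj_on r(3) assms(2)
    by blast
qed

lemma mult_neg_perturb:
  fixes a b c :: real
  assumes "a * b < 0" "\<bar>c\<bar> < \<bar>a\<bar>" "\<bar>c\<bar> < \<bar>b\<bar>"
  shows "(a + c) * (b + c) < 0"
  using assms unfolding mult_less_0_iff by linarith

text \<open>The test points are the midpoints of consecutive roots and one point beyond each extreme
  root. At all of them the unshifted polynomial dominates \<open>c\<close>, so the shift preserves
  its alternating signs.\<close>

lemma perturbed_roots:
  fixes r :: "nat \<Rightarrow> real"
  assumes "strict_mono_on {..<d} r" and "1 \<le> d" and "0 < C"
    and mid: "\<And>k. Suc k < d \<Longrightarrow> \<bar>c\<bar> < C * (\<Prod>i<d. \<bar>(r k + r (Suc k)) / 2 - r i\<bar>)"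
  shows "\<exists>\<rho>. smult C (\<Prod>i<d. [:- r i, 1:]) + [:c:] = smult C (\<Prod>i<d. [:- \<rho> i, 1:])"
proof -
  let ?f = "smult C (\<Prod>i<d. [:- r i, 1:])"
  \<comment> \<open>At distance \<open>K\<close> outside all roots the product is at least
    \<open>K ^ d\<close>, and \<open>1 \<le> K\<close> gives \<open>K \<le> K ^ d\<close>; the
    quotient by \<open>C\<close> then makes \<open>C * K\<close> exceed the shift.\<close>
  define K where "K = 1 + \<bar>c\<bar> / C"
  define \<eta> where "\<eta> k = (if k = 0 then r 0 - K else if k = d then r (d - 1) + K
    else (r (k - 1) + r k) / 2)" for k
  have K: "1 \<le> K" "\<bar>c\<bar> < C * K" using assms(3) by (auto simp: K_def field_simps)
  have lt: "r j < r k" if "j < k" "k < d" for j k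
    using strict_mono_onD[OF assms(1), of j k] that by simp
  have le: "r j \<le> r k" if "j \<le> k" "k < d" for j k
    using lt[of j k] that by (cases "j = k") auto
  have below: "\<eta> k < r k" if "k < d" for k
    using that K(1) lt[of "k - 1" k] by (auto simp: \<eta>_def)
  have above: "r k < \<eta> (Suc k)" if "k < d" for k
    using that K(1) lt[of k "Suc k"] by (auto simp: \<eta>_def)
  have "strict_mono_on {..d} \<eta>"
  proof (rule strict_mono_onI)
    fix i j assume ij: "i \<in> {..d}" "j \<in> {..d}" "i < j"
    then obtain l where l: "j = Suc l" by (cases j) auto
    have "\<eta> i < r i" "r i \<le> r l" "r l < \<eta> j"
      using below[of i] le[of i l] above[of l] ij l by auto
    then show "\<eta> i < \<eta> j" by linarith
  qed
  moreover have big: "\<bar>c\<bar> < \<bar>poly ?f (\<eta> k)\<bar>" if "k \<le> d" for k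
  proof -
    have "\<bar>c\<bar> < C * (\<Prod>i<d. \<bar>\<eta> k - r i\<bar>)"
    proof (cases "k = 0 \<or> k = d")
      case True
      have "K ^ 1 \<le> K ^ d" using K assms(2) by (intro power_increasing) auto
      also have "\<dots> = (\<Prod>i<d. K)" by simp
      also have "\<dots> \<le> (\<Prod>i<d. \<bar>\<eta> k - r i\<bar>)"
      proof (rule prod_mono, intro conjI)
        fix i assume "i \<in> {..<d}"
        then have "r 0 \<le> r i" "r i \<le> r (d - 1)" using le[of 0 i] le[of i "d - 1"] by auto
        then show "K \<le> \<bar>\<eta> k - r i\<bar>" using True assms(2) by (auto simp: \<eta>_def)
      qed (use K in simp)
      finally have "C * K \<le> C * (\<Prod>i<d. \<bar>\<eta> k - r i\<bar>)"
        using assms(3) by (intro mult_left_mono) auto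
      then show ?thesis using K(2) by linarith
    next
      case False
      then show ?thesis using mid[of "k - 1"] that by (auto simp: \<eta>_def)
    qed
    then show ?thesis using assms(3) by (simp add: poly_prod abs_mult abs_prod)
  qed
  \<comment> \<open>Between \<open>\<eta> k\<close> and \<open>\<eta> (Suc k)\<close> lies the
    single root \<open>r k\<close>, so exactly one of the paired factors is negative.\<close>
  have sgn: "poly ?f (\<eta> k) * poly ?f (\<eta> (Suc k)) < 0" if "k < d" for k
  proof -
    have pos: "0 < (\<eta> k - r i) * (\<eta> (Suc k) - r i)" if "i \<in> {..<d} - {k}" for i
    proof (cases "i < k")
      case True
      then obtain l where "k = Suc l" "i \<le> l" by (cases k) auto
      then have "r i < \<eta> k" "r i < \<eta> (Suc k)"
        using above[of l] above[of k] le[of i l] le[of i k] \<open>k < d\<close> by auto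
      then show ?thesis by simp
    next
      case False
      then have "Suc k \<le> i" "i < d" using that by auto
      then have "\<eta> k < r i" "\<eta> (Suc k) < r i"
        using below[of k] below[of "Suc k"] le[of k i] le[of "Suc k" i] by auto
      then show ?thesis by (simp add: mult_neg_neg)
    qed
    have "(\<Prod>i<d. (\<eta> k - r i) * (\<eta> (Suc k) - r i)) =
      ((\<eta> k - r k) * (\<eta> (Suc k) - r k)) * (\<Prod>i\<in>{..<d} - {k}. (\<eta> k - r i) * (\<eta> (Suc k) - r i))"
      using that by (intro prod.remove) auto
    also have "\<dots> < 0"
      using below[OF that] above[OF that] by (intro mult_neg_pos prod_pos pos) auto
    finally have "C^2 * (\<Prod>i<d. (\<eta> k - r i) * (\<eta> (Suc k) - r i)) < 0"
      using assms(3) by (intro mult_pos_neg) auto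
    then show ?thesis
      by (simp add: poly_prod prod.distrib power2_eq_square mult_ac)
  qed
  have "poly (?f + [:c:]) (\<eta> k) * poly (?f + [:c:]) (\<eta> (Suc k)) < 0" if "k < d" for k
    using mult_neg_perturb[OF sgn[OF that] big[of k] big[of "Suc k"]] that by simp
  moreover have deg: "degree (\<Prod>i<d. [:- r i, 1:]) = d"
    by (subst degree_prod_sum_eq) auto
  then have "degree (?f + [:c:]) \<le> d" by (intro degree_add_le) auto
  moreover have "coeff (?f + [:c:]) d = C"
    using lead_coeff_prod[of "\<lambda>i. [:- r i, 1:]" "{..<d}"] deg assms(2)
    by (simp add: coeff_pCons split: nat.split)
  ultimately show ?thesis
    using roots_of_alternating[of d \<eta> "?f + [:c:]"] by auto
qed

section \<open>Bounding matching products by root gaps\<close>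

text \<open>The weight \<open>w v\<close> is \<open>b - a\<close> plus the distance from
  \<open>v\<close> to the interval, so the triangle inequality through the interval bounds the
  distance of \<open>u\<close> and \<open>v\<close>. Expanding a product of two nonnegative excesses
  then separates the two points, which turns a product over edges into one over vertices.\<close>

lemma interval_weight_pair:
  fixes a b u v :: real
  assumes "a \<le> b"
  defines "w \<equiv> \<lambda>v. max (b - a) (max (b - v) (v - a))"
  shows "\<bar>u - v\<bar> * (b - a) \<le> w u * w v"
proof -
  have "\<bar>u - v\<bar> \<le> w u + w v - (b - a)"
    using assms(1) unfolding w_def by (simp add: max_def abs_if)
  then have "\<bar>u - v\<bar> * (b - a) \<le> (w u + w v - (b - a)) * (b - a)"
    using assms(1) by (intro mult_right_mono) auto
  also have "\<dots> \<le> w u * w v"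
  proof -
    have "0 \<le> (w u - (b - a)) * (w v - (b - a))"
      unfolding w_def by (intro mult_nonneg_nonneg) auto
    then show ?thesis by (simp add: algebra_simps)
  qed
  finally show ?thesis .
qed

text \<open>The bound does not depend on \<open>M\<close>: weights of unmatched indices are inserted
  until all \<open>n\<close> indices occur. Its factors are, up to powers of \<open>n\<close>, the
  lower bounds for the distances from each root to the farther of the roots number \<open>k\<close>
  and \<open>Suc k\<close> of \<open>esym_poly n d x\<close>.\<close>

lemma abs_q_match_le:
  fixes x y :: "nat \<Rightarrow> real"
  assumes mono: "strict_mono_on {..<n} y" and bij: "bij_betw y {..<n} ((\<lambda>i. - x i) ` {1..n})"
    and inj: "inj_on x {1..n}" and M: "is_matching n d M" and "2 * d \<le> n" and "Suc k < d"
  shows "\<bar>q_match M x\<bar> \<le>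
    (\<Prod>i<d. if i \<le> k then y (Suc k + (n - d)) - y i else y (i + (n - d)) - y k)"
proof -
  define m where "m = n - d"
  \<comment> \<open>This is the stretch of original roots whose length controls the gap between
    roots \<open>k\<close> and \<open>Suc k\<close> after \<open>n - d\<close>
    differentiations.\<close>
  define a b where "a = y k" and "b = y (Suc k + m)"
  \<comment> \<open>The distance from \<open>v\<close> to the farther end of the interval when \<open>v\<close> lies outside it, and the
    length of the interval otherwise. There are exactly \<open>n - d\<close> roots strictly inside, so of the
    product of all weights only \<open>d\<close> nontrivial factors remain.\<close>
  define w where "w v = max (b - a) (max (b - v) (v - a))" for v
  define W where "W i = w (- x i)" for i
  define h where "h i = (if i \<le> k then b - y i else y (i + m) - a)" for i
  have n: "n = d + m" "d \<le> m" using assms(5) by (auto simp: m_def)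
  have lt: "y i < y j" if "i < j" "j < n" for i j
    using strict_mono_onD[OF mono, of i j] that by simp
  have le: "y i \<le> y j" if "i \<le> j" "j < n" for i j
    using lt[of i j] that by (cases "i = j") auto
  have ab: "a < b" using lt[of k "Suc k + m"] assms(6) n by (simp add: a_def b_def)
  have wge: "b - a \<le> W i" for i by (simp add: W_def w_def)
  have edge: "e \<subseteq> {1..n}" "card e = 2" if "e \<in> M" for e
    using M that by (auto simp: is_matching_def)
  have disj: "\<forall>e\<in>M. \<forall>f\<in>M. e \<noteq> f \<longrightarrow> e \<inter> f = {}" and cardM: "card M = d"
    using M by (auto simp: is_matching_def)
  have fin: "\<forall>e\<in>M. finite e" using edge finite_subset by blast
  have sub: "\<Union>M \<subseteq> {1..n}" using edge by blast
  have "pairwise disjnt M" using disj by (auto simp: pairwise_def disjnt_def)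
  then have "card (\<Union>M) = (\<Sum>e\<in>M. card e)"
    using fin by (intro card_Union_disjoint) auto
  also have "\<dots> = (\<Sum>e\<in>M. 2)" using edge by (intro sum.cong) auto
  finally have cardU: "card (\<Union>M) = 2 * d" using cardM by simp
  have "\<bar>q_match M x\<bar> * (b - a) ^ d = (\<Prod>e\<in>M. \<bar>x (Min e) - x (Max e)\<bar> * (b - a))"
    using cardM by (simp add: q_match_def abs_prod prod.distrib)
  also have "\<dots> \<le> (\<Prod>e\<in>M. \<Prod>i\<in>e. W i)"
  proof (intro prod_mono conjI)
    fix e assume "e \<in> M"
    then obtain p q where e: "e = {p, q}" "p \<noteq> q" using edge card_2_iff by metis
    have "\<bar>x (Min e) - x (Max e)\<bar> = \<bar>(- x p) - (- x q)\<bar>"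
      using e by (auto simp: min_def max_def)
    then show "\<bar>x (Min e) - x (Max e)\<bar> * (b - a) \<le> (\<Prod>i\<in>e. W i)"
      using interval_weight_pair[of a b "- x p" "- x q"] ab e unfolding W_def w_def by simp
  qed (use ab in simp)
  also have "\<dots> = (\<Prod>i\<in>\<Union>M. W i)"
    using prod.Union_disjoint[OF fin disj, of W] by simp
  finally have 1: "\<bar>q_match M x\<bar> * (b - a) ^ d \<le> (\<Prod>i\<in>\<Union>M. W i)" .
  \<comment> \<open>The matching covers \<open>2 * d\<close> indices, so \<open>m - d\<close>
    remain, each with weight at least \<open>b - a\<close>.\<close>
  have "(b - a) ^ (m - d) = (\<Prod>i\<in>{1..n} - \<Union>M. b - a)"
    using cardU sub n fin by (subst prod_constant, subst card_Diff_subset) (auto intro: finite_subset)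
  also have "\<dots> \<le> (\<Prod>i\<in>{1..n} - \<Union>M. W i)"
    using ab wge by (intro prod_mono) auto
  finally have 2: "(b - a) ^ (m - d) \<le> (\<Prod>i\<in>{1..n} - \<Union>M. W i)" .
  have W0: "0 \<le> W i" for i using wge[of i] ab by linarith
  have "\<bar>q_match M x\<bar> * (b - a) ^ m = \<bar>q_match M x\<bar> * (b - a) ^ d * (b - a) ^ (m - d)"
    using n by (simp add: power_add[symmetric] mult.assoc)
  also have "\<dots> \<le> (\<Prod>i\<in>\<Union>M. W i) * (\<Prod>i\<in>{1..n} - \<Union>M. W i)"
    using 1 2 ab W0 by (intro mult_mono prod_nonneg) auto
  also have "\<dots> = (\<Prod>i\<in>{1..n}. W i)"
    using prod.subset_diff[OF sub, of W] by (simp add: mult.commute)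
  also have "\<dots> = (\<Prod>v\<in>(\<lambda>i. - x i) ` {1..n}. w v)"
  proof -
    have "inj_on (\<lambda>i. - x i) {1..n}"
      by (rule inj_onI) (use inj_onD[OF inj] in \<open>simp only: neg_equal_iff_equal\<close>)
    then show ?thesis by (simp only: prod.reindex o_def W_def)
  qed
  also have "\<dots> = (\<Prod>i<n. w (y i))"
    by (rule prod.reindex_bij_betw[OF bij, symmetric])
  \<comment> \<open>In sorted order the roots fall into those up to \<open>a\<close>, the
    \<open>m\<close> inside, and those from \<open>b\<close> on. Shifting the last block down by
    \<open>m\<close> makes the outer blocks fill the indices below \<open>d\<close>, while the inner
    one cancels \<open>(b - a) ^ m\<close>.\<close>
  also have "\<dots> = (\<Prod>i=0..<Suc k. w (y i)) * (\<Prod>i=Suc k..<Suc k + m. w (y i))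
      * (\<Prod>i=Suc k + m..<d + m. w (y i))"
    using assms(6) by (simp only: n(1) lessThan_atLeast0 prod.atLeastLessThan_concat le0 le_add1
        add_le_cancel_right less_imp_le)
  also have "(\<Prod>i=0..<Suc k. w (y i)) = (\<Prod>i=0..<Suc k. h i)"
  proof (rule prod.cong[OF refl])
    fix i assume i: "i \<in> {0..<Suc k}"
    then have "y i \<le> a" using le[of i k] assms(6) n by (auto simp: a_def)
    then show "w (y i) = h i" using i ab by (auto simp: w_def h_def)
  qed
  also have "(\<Prod>i=Suc k..<Suc k + m. w (y i)) = (\<Prod>i=Suc k..<Suc k + m. b - a)"
  proof (rule prod.cong[OF refl])
    fix i assume i: "i \<in> {Suc k..<Suc k + m}"
    then have "a \<le> y i" "y i \<le> b"
      using le[of k i] le[of i "Suc k + m"] assms(6) n by (auto simp: a_def b_def)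
    then show "w (y i) = b - a" by (auto simp: w_def)
  qed
  also have "(\<Prod>i=Suc k + m..<d + m. w (y i)) = (\<Prod>i=Suc k..<d. w (y (i + m)))"
    by (rule prod.shift_bounds_nat_ivl)
  also have "\<dots> = (\<Prod>i=Suc k..<d. h i)"
  proof (rule prod.cong[OF refl])
    fix i assume i: "i \<in> {Suc k..<d}"
    then have "b \<le> y (i + m)" using le[of "Suc k + m" "i + m"] n by (auto simp: b_def)
    then show "w (y (i + m)) = h i" using i ab by (auto simp: w_def h_def)
  qed
  also have "(\<Prod>i=0..<Suc k. h i) * (\<Prod>i=Suc k..<Suc k + m. b - a) * (\<Prod>i=Suc k..<d. h i)
      = (\<Prod>i<d. h i) * (b - a) ^ m"
  proof -
    have "(\<Prod>i=0..<Suc k. h i) * (\<Prod>i=Suc k..<d. h i) = (\<Prod>i<d. h i)"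
      using assms(6) by (simp only: lessThan_atLeast0 prod.atLeastLessThan_concat)
    then show ?thesis by (simp add: mult_ac)
  qed
  finally have "\<bar>q_match M x\<bar> \<le> (\<Prod>i<d. h i)" using ab by simp
  then show ?thesis unfolding h_def a_def b_def m_def by simp
qed

section \<open>Complex evaluation of real polynomials\<close>

lemma map_poly_of_real_hom:
  fixes p q :: "real poly"
  shows "map_poly complex_of_real (p + q) = map_poly complex_of_real p + map_poly complex_of_real q"
    and "map_poly complex_of_real (p * q) = map_poly complex_of_real p * map_poly complex_of_real q"
  by (simp_all add: poly_eq_iff coeff_map_poly coeff_mult)

lemma map_poly_of_real_sum:
  "map_poly complex_of_real (\<Sum>i\<in>A. f i) = (\<Sum>i\<in>A. map_poly complex_of_real (f i))"
  by (induction A rule: infinite_finite_induct) (auto simp: map_poly_of_real_hom)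

lemma map_poly_of_real_prod:
  "map_poly complex_of_real (\<Prod>i\<in>A. f i) = (\<Prod>i\<in>A. map_poly complex_of_real (f i))"
  by (induction A rule: infinite_finite_induct) (auto simp: map_poly_of_real_hom map_poly_1)

lemma map_poly_of_real_esym_poly:
  "map_poly complex_of_real (esym_poly n d x) = esym_poly n d (\<lambda>i. of_real (x i))"
  by (simp add: esym_poly_def map_poly_of_real_sum map_poly_of_real_prod map_poly_pCons)

text \<open>Since \<open>r i\<close> is real, each factor \<open>z - r i\<close> has imaginary part
  \<open>Im z\<close>.\<close>

lemma norm_poly_real_roots_ge:
  "\<bar>C\<bar> * \<bar>Im z\<bar> ^ d \<le>
    cmod (poly (map_poly complex_of_real (smult C (\<Prod>i<d. [:- r i, 1:]))) z)"
proof -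
  have "\<bar>Im z\<bar> ^ d = (\<Prod>i<d. \<bar>Im (z - of_real (r i))\<bar>)" by simp
  also have "\<dots> \<le> (\<Prod>i<d. cmod (z - of_real (r i)))"
    by (intro prod_mono) (auto simp: abs_Im_le_cmod simp del: minus_complex.sel)
  finally have "\<bar>C\<bar> * \<bar>Im z\<bar> ^ d \<le> \<bar>C\<bar> * (\<Prod>i<d. cmod (z - of_real (r i)))"
    by (intro mult_left_mono) auto
  moreover have "map_poly complex_of_real (smult C (\<Prod>i<d. [:- r i, 1:]))
      = smult (of_real C) (\<Prod>i<d. [:- of_real (r i), 1:])"
    by (simp add: map_poly_smult map_poly_of_real_prod map_poly_pCons)
  ultimately show ?thesis
    by (simp add: poly_prod norm_mult prod_norm[symmetric])
qed

section \<open>The case of distinct coordinates\<close>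

text \<open>Both sides of the midpoint condition in \<open>perturbed_roots\<close> are compared with
  the product of the same numbers \<open>h i\<close>: from above for the matching products, from
  below for the root distances.\<close>

lemma esym_poly_perturbation_roots:
  fixes x :: "nat \<Rightarrow> real"
  assumes inj: "inj_on x {1..n}" and d: "1 \<le> d" "2 * d \<le> n"
    and M: "\<forall>M\<in>\<M>. is_matching n d M"
    and s: "(\<Sum>M\<in>\<M>. \<bar>s M\<bar>) \<le> real (n choose d) / (2 ^ n * real n ^ ((d + 1) * (n - d)))"
  shows "\<exists>\<rho>. esym_poly n d x + [:\<Sum>M\<in>\<M>. s M * q_match M x:]
    = smult (real (n choose d)) (\<Prod>i<d. [:- \<rho> i, 1:])"
proof -
  define m where "m = n - d"
  define C where "C = real (n choose d)"
  define N where "N = real n ^ m"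
  let ?c = "\<Sum>M\<in>\<M>. s M * q_match M x"
  have dn: "d = n - m" "m \<le> n" "d + m = n" using d by (auto simp: m_def)
  have C: "0 < C" using d by (simp add: C_def)
  have N: "0 < N" using d by (simp add: N_def)
  have "inj_on (\<lambda>i. - x i) {1..n}"
    by (rule inj_onI) (use inj_onD[OF inj] in \<open>simp only: neg_equal_iff_equal\<close>)
  then have card: "card ((\<lambda>i. - x i) ` {1..n}) = n" by (simp add: card_image)
  obtain y where y: "strict_mono_on {..<n} y" "bij_betw y {..<n} ((\<lambda>i. - x i) ` {1..n})"
    by (rule sorted_enumeration[of "(\<lambda>i. - x i) ` {1..n}", unfolded card]) auto
  have choose: "n choose m = n choose d"
    using binomial_symmetric[of d n] d by (simp add: m_def)
  obtain r where r: "strict_mono_on {..<d} r"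
    and E: "esym_poly n d x = smult C (\<Prod>i<d. [:- r i, 1:])"
    and gap: "\<And>i j. i < j \<Longrightarrow> j < d \<Longrightarrow> (y (j + m) - y i) / N \<le> r j - r i"
    using esym_poly_roots[OF y inj dn(2)]
    unfolding dn(1)[symmetric] choose C_def N_def by blast
  have lt: "y i < y j" if "i < j" "j < n" for i j
    using strict_mono_onD[OF y(1), of i j] that by simp
  have "\<bar>?c\<bar> < C * (\<Prod>i<d. \<bar>(r k + r (Suc k)) / 2 - r i\<bar>)" if k: "Suc k < d" for k
  proof -
    define h where "h i = (if i \<le> k then y (Suc k + m) - y i else y (i + m) - y k)" for i
    have h: "0 < h i" if "i < d" for i
      using lt[of i "Suc k + m"] lt[of k "i + m"] that k dn(3) by (auto simp: h_def)
    have D: "0 < (\<Prod>i<d. h i)" using h by (intro prod_pos) auto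
    have q: "\<bar>q_match M x\<bar> \<le> (\<Prod>i<d. h i)" if "M \<in> \<M>" for M
      using abs_q_match_le[OF y inj _ d(2) k, of M, folded m_def] M that unfolding h_def by blast
    have "\<bar>?c\<bar> \<le> (\<Sum>M\<in>\<M>. \<bar>s M\<bar> * \<bar>q_match M x\<bar>)"
      using sum_abs[of "\<lambda>M. s M * q_match M x" \<M>] by (simp add: abs_mult)
    also have "\<dots> \<le> (\<Sum>M\<in>\<M>. \<bar>s M\<bar> * (\<Prod>i<d. h i))"
      by (intro sum_mono mult_left_mono q) auto
    also have "\<dots> = (\<Sum>M\<in>\<M>. \<bar>s M\<bar>) * (\<Prod>i<d. h i)"
      by (simp add: sum_distrib_right)
    also have "\<dots> \<le> C / (2 ^ n * real n ^ ((d + 1) * (n - d))) * (\<Prod>i<d. h i)"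
      using s D unfolding C_def by (intro mult_right_mono) auto
    \<comment> \<open>The norm bound leaves room: \<open>N ^ d\<close> has exponent
      \<open>d * (n - d)\<close>, below \<open>(d + 1) * (n - d)\<close>, and strictness comes from
      \<open>d < n\<close> in the powers of two.\<close>
    also have "\<dots> < C / (2 * N) ^ d * (\<Prod>i<d. h i)"
    proof (intro mult_strict_right_mono divide_strict_left_mono)
      have "N ^ d \<le> real n ^ ((d + 1) * (n - d))"
        unfolding N_def m_def power_mult[symmetric] using d
        by (intro power_increasing) (auto simp: mult.commute)
      moreover have "(2::real) ^ d < 2 ^ n" using d by (intro power_strict_increasing) auto
      ultimately show "(2 * N) ^ d < 2 ^ n * real n ^ ((d + 1) * (n - d))"
        unfolding power_mult_distrib using N by (intro mult_less_le_imp_less) auto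
    qed (use C D N d in auto)
    also have "\<dots> = C * (\<Prod>i<d. h i / (2 * N))"
      by (simp add: prod_dividef)
    also have "\<dots> \<le> C * (\<Prod>i<d. \<bar>(r k + r (Suc k)) / 2 - r i\<bar>)"
    proof (intro mult_left_mono prod_mono conjI)
      fix i assume "i \<in> {..<d}"
      then have i: "i < d" by simp
      show "0 \<le> h i / (2 * N)" using h[OF i] N by simp
      have half: "h i / (2 * N) = h i / N / 2" by simp
      have kk: "r k < r (Suc k)" using strict_mono_onD[OF r, of k "Suc k"] k by simp
      \<comment> \<open>The midpoint is at least half as far from \<open>r i\<close> as the farther
        of \<open>r k\<close> and \<open>r (Suc k)\<close>, and the gap bound applies to that
        farther root.\<close>
      show "h i / (2 * N) \<le> \<bar>(r k + r (Suc k)) / 2 - r i\<bar>"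
      proof (cases "i \<le> k")
        case True
        have "r i \<le> r k" using strict_mono_onD[OF r, of i k] True k by (cases "i = k") auto
        moreover have "h i / N \<le> r (Suc k) - r i"
          using gap[of i "Suc k"] True k by (simp add: h_def)
        ultimately show ?thesis unfolding half using kk by (simp add: field_simps)
      next
        case False
        then have "r (Suc k) \<le> r i"
          using strict_mono_onD[OF r, of "Suc k" i] k i by (cases "i = Suc k") auto
        moreover have "h i / N \<le> r i - r k"
          using gap[of k i] False i by (simp add: h_def)
        ultimately show ?thesis unfolding half using kk by (simp add: field_simps)
      qed
    qed (use C in simp)
    finally show ?thesis .
  qed
  from perturbed_roots[OF r d(1) C this] show ?thesis
    unfolding E C_def[symmetric] .
qed

section \<open>Coinciding coordinates by a limit\<close>

text \<open>Equal coordinates are separated by every positive shift, distinct ones stay apart near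
  zero by continuity, and only finitely many pairs occur.\<close>

lemma eventually_inj_on_shift:
  fixes x :: "nat \<Rightarrow> real"
  assumes "finite A"
  shows "\<forall>\<^sub>F \<epsilon> in at_right 0. inj_on (\<lambda>i. x i + \<epsilon> * real i) A"
proof -
  have "\<forall>\<^sub>F \<epsilon> in at_right 0. x i + \<epsilon> * real i \<noteq> x j + \<epsilon> * real j" if "i \<noteq> j" for i j
  proof (cases "x i = x j")
    case True
    have "\<forall>\<^sub>F \<epsilon> in at_right 0. (0::real) < \<epsilon>" by (rule eventually_at_right_less)
    then show ?thesis by eventually_elim (use True that in simp)
  next
    case False
    have "((\<lambda>\<epsilon>. x i + \<epsilon> * real i - (x j + \<epsilon> * real j)) \<longlongrightarrow> x i + 0 * real i - (x j + 0 * real j)) (at_right 0)"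
      by (intro tendsto_intros)
    then have "\<forall>\<^sub>F \<epsilon> in at_right 0. x i + \<epsilon> * real i - (x j + \<epsilon> * real j) \<noteq> 0"
      by (rule tendsto_imp_eventually_ne) (use False in simp)
    then show ?thesis by eventually_elim simp
  qed
  then have "\<forall>\<^sub>F \<epsilon> in at_right 0. \<forall>i\<in>A. \<forall>j\<in>A. i \<noteq> j \<longrightarrow> x i + \<epsilon> * real i \<noteq> x j + \<epsilon> * real j"
    using assms by (intro eventually_ball_finite ballI) auto
  then show ?thesis
    by eventually_elim (auto simp: inj_on_def)
qed

theorem theorem4:
  fixes n d :: nat
    and \<M> :: "nat set set set"
    and \<S> :: "nat set set"
    and s :: "nat set set \<Rightarrow> real"
  assumes "1 \<le> d" and "2 * d \<le> n"
    and "\<forall>M\<in>\<M>. is_matching n d M"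
    and "\<forall>S\<in>\<S>. S \<subseteq> {1..n} \<and> card S = d"
    and "\<forall>S\<in>\<S>. \<exists>!M. M \<in> \<M> \<and> fully_crosses M S"
    and "\<forall>M\<in>\<M>. \<exists>S\<in>\<S>. fully_crosses M S"
    and "(\<Sum>M\<in>\<M>. \<bar>s M\<bar>) \<le> real (n choose d) / (2 ^ n * real n ^ ((d + 1) * (n - d)))"
  shows "hyperbolic_wrt (\<lambda>x. elem_sym n d x + (\<Sum>M\<in>\<M>. s M * q_match M x)) (\<lambda>_. 1)"
  unfolding hyperbolic_wrt_def
proof (intro conjI allI)
  \<comment> \<open>As \<open>1 \<le> d\<close>, the product has at least one factor and all factors
    vanish, so the value at the all-ones point is the binomial coefficient.\<close>
  have "q_match M (\<lambda>_. 1) = 0" if "M \<in> \<M>" for M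
  proof -
    have "card M = d" using assms(3) that by (simp add: is_matching_def)
    then show ?thesis using assms(1) by (simp add: q_match_def power_0_left)
  qed
  then show "elem_sym n d (\<lambda>_. 1) + (\<Sum>M\<in>\<M>. s M * q_match M (\<lambda>_. 1)) \<noteq> 0"
    using assms(2) n_subsets[of "{1..n}" d] by (simp add: elem_sym_def)
  fix x :: "nat \<Rightarrow> real"
  define c where "c = esym_poly n d x + [:\<Sum>M\<in>\<M>. s M * q_match M x:]"
  have "q_match M (\<lambda>i. t + x i) = q_match M x" for M t
    by (simp add: q_match_def)
  then have "poly c t = elem_sym n d (\<lambda>i. t * 1 + x i) + (\<Sum>M\<in>\<M>. s M * q_match M (\<lambda>i. t * 1 + x i))" for t
    by (simp add: c_def poly_esym_poly)
  moreover have "real_rooted c"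
    unfolding real_rooted_def
  proof (intro allI impI)
    fix z assume z: "poly (map_poly complex_of_real c) z = 0"
    define x' where "x' = (\<lambda>\<epsilon> i. x i + \<epsilon> * real i)"
    define F where "F \<epsilon> = poly (map_poly complex_of_real
      (esym_poly n d (x' \<epsilon>) + [:\<Sum>M\<in>\<M>. s M * q_match M (x' \<epsilon>):])) z" for \<epsilon>
    \<comment> \<open>Written out as finite sums and products, \<open>F\<close> is visibly
      continuous in \<open>\<epsilon>\<close>.\<close>
    have F: "F \<epsilon> = (\<Sum>S | S \<subseteq> {1..n} \<and> card S = d. \<Prod>i\<in>S. of_real (x' \<epsilon> i) + z)
        + of_real (\<Sum>M\<in>\<M>. s M * q_match M (x' \<epsilon>))" for \<epsilon>
      unfolding F_def map_poly_of_real_hom map_poly_of_real_esym_poly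
      by (simp add: esym_poly_def poly_sum poly_prod map_poly_pCons)
    have "(F \<longlongrightarrow> F 0) (at_right 0)"
      unfolding F x'_def q_match_def by (intro tendsto_intros)
    then have "((\<lambda>\<epsilon>. cmod (F \<epsilon>)) \<longlongrightarrow> cmod (F 0)) (at_right 0)"
      by (rule tendsto_norm)
    moreover have "\<forall>\<^sub>F \<epsilon> in at_right 0. real (n choose d) * \<bar>Im z\<bar> ^ d \<le> cmod (F \<epsilon>)"
      using eventually_inj_on_shift[OF finite_atLeastAtMost, of x 1 n]
    proof eventually_elim
      case (elim \<epsilon>)
      then have "inj_on (x' \<epsilon>) {1..n}" by (simp add: x'_def)
      from esym_poly_perturbation_roots[OF this assms(1-3,7)]
      show ?case using norm_poly_real_roots_ge[of "real (n choose d)" z d]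
        unfolding F_def by auto
    qed
    \<comment> \<open>The lower bound holds for small positive \<open>\<epsilon>\<close>, where the
      coordinates are distinct, and passes to the limit; \<open>F 0\<close> is the value at the
      given root \<open>z\<close>.\<close>
    ultimately have "real (n choose d) * \<bar>Im z\<bar> ^ d \<le> cmod (F 0)"
      by (intro tendsto_lowerbound) auto
    moreover have "F 0 = 0"
      using z by (simp add: F_def x'_def c_def)
    ultimately have "real (n choose d) * \<bar>Im z\<bar> ^ d \<le> 0" by simp
    then have "\<bar>Im z\<bar> ^ d \<le> 0"
      using assms(2) by (simp add: mult_le_0_iff)
    then show "Im z = 0"
      by (metis abs_ge_zero abs_eq_0 power_eq_0_iff zero_le_power order_antisym)
  qed
  ultimately show "\<exists>c. (\<forall>t. poly c t = elem_sym n d (\<lambda>i. t * 1 + x i)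
      + (\<Sum>M\<in>\<M>. s M * q_match M (\<lambda>i. t * 1 + x i))) \<and> real_rooted c"
    by blast
qed

end
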